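(* Let $\Pi\in\mathcal{S}$ where the output $G$ belongs to a graph class $\mathcal{G}$. Suppose that there is a polynomial $\rho_1$-approximation for $\Pi$, and that $c^{max}(G)\leq \rho_2\, c(G)$ for any $G\in\mathcal{G}$. Then, using this $\rho_1$-approximation in the algorithm that returns a $\rho_1$-approximate solution of $\min_{G\in\mathcal{G}} c^{max}(G)$ yields a polynomial $\rho_1\rho_2$-approximation for Robust-$\Pi$.
   Context: $\mathbb{G}=(\mathbb{V},\mathbb{E})$ is a graph embedded in a metric space $(\mathcal{M},d)$; $\mathcal{S}$ is the class of problems $\Pi$ of the form $\min_{G\in\mathcal{G}}\sum_{\{i,j\}\in E[G]} d(u_i,u_j)$, where $\mathcal{G}$ is a family of feasible subgraphs of $\mathbb{G}$ and $u_i\in\mathcal{M}$ is the position of vertex $i$. Robust-$\Pi$ is its robust counterpart: each vertex $i$ has a finite set $\mathcal{U}_i\subseteq\mathcal{M}$ of possible positions, $\mathcal{U}=\times_i\mathcal{U}_i$, and one solves $\min_{G\in\mathcal{G}} c(G)$ with $c(G)=\max_{u\in\mathcal{U}}\sum_{\{i,j\}\in E[G]} d(u_i,u_j)$. Worst-case distances are $d^{max}_{ij}=\max_{u_i\in\mathcal{U}_i,u_j\in\mathcal{U}_j} d(u_i,u_j)$ and $c^{max}(G)=\sum_{\{i,j\}\in E[G]} d^{max}_{ij}$. Since $d'(\mathcal{U}_i,\mathcal{U}_j)=d^{max}_{ij}$ is a metric on $\{\mathcal{U}_i\}$, $\min_{G\in\mathcal{G}}c^{max}(G)$ is an instance of $\Pi$;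 the algorithm considered applies the given approximation algorithm for $\Pi$ to this instance and returns its output. *)

theory Defs
  imports "HOL-Analysis.Abstract_Metric_Spaces"
    "HOL-Computational_Algebra.Polynomial"
    "HOL-Library.FuncSet"
    "HOL-Library.Log_Nat"
begin

section \<open>Model of computation\<close>

text \<open>
  Algorithms are WHILE programs over S-expressions with numbers as atoms. Two cost models are
  supported, so that ``polynomial'' can be read in either of its usual senses:
  \<^item> \<open>Bit_Model\<close>: numbers are rational and an arithmetic operation or a comparison costs the bit
    length of the numbers involved (logarithmic cost; polynomially equivalent to Turing machines);
  \<^item> \<open>Real_RAM\<close>: numbers are arbitrary reals and every operation has unit cost.

  Pairing and projections cost one unit in both models, as S-expressions can be shared.
\<close>

datatype 'a sexp = Emp | Atom 'a | Pair "'a sexp" "'a sexp"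

datatype cost_model = Bit_Model | Real_RAM

fun numbers :: "cost_model \<Rightarrow> real set" where
  "numbers Bit_Model = \<rat>"
| "numbers Real_RAM = UNIV"

fun num_size :: "cost_model \<Rightarrow> real \<Rightarrow> nat" where
  "num_size Bit_Model x =
     (let (a, b) = quotient_of (inv of_rat x) in nat (bitlen \<bar>a\<bar>) + nat (bitlen b))"
| "num_size Real_RAM x = 1"

fun input_size :: "cost_model \<Rightarrow> real sexp \<Rightarrow> nat" where
  "input_size m Emp = 1"
| "input_size m (Atom x) = num_size m x"
| "input_size m (Pair l r) = 1 + input_size m l + input_size m r"

datatype arith_op = Plus | Minus | Times | Divide

datatype expr =
  Var nat | Empty | Zero | One | MkPair expr expr | Head expr | Tail expr | Arith arith_op expr expr

datatype cond = IsPair expr | IsAtom expr | Leq expr expr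

datatype com = Skip | Assign nat expr | Seq com com | Cond cond com com | While cond com

type_synonym store = "nat \<Rightarrow> real sexp"

fun head :: "real sexp \<Rightarrow> real sexp" where
  "head (Pair l r) = l"
| "head _ = Emp"

fun tail :: "real sexp \<Rightarrow> real sexp" where
  "tail (Pair l r) = r"
| "tail _ = Emp"

fun num_of :: "real sexp \<Rightarrow> real" where
  "num_of (Atom x) = x"
| "num_of _ = 0"

fun arith :: "arith_op \<Rightarrow> real \<Rightarrow> real \<Rightarrow> real" where
  "arith Plus x y = x + y"
| "arith Minus x y = x - y"
| "arith Times x y = x * y"
| "arith Divide x y = x / y"

fun expr_val :: "expr \<Rightarrow> store \<Rightarrow> real sexp" where
  "expr_val (Var v) s = s v"
| "expr_val Empty s = Emp"
| "expr_val Zero s = Atom 0"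
| "expr_val One s = Atom 1"
| "expr_val (MkPair e f) s = Pair (expr_val e s) (expr_val f s)"
| "expr_val (Head e) s = head (expr_val e s)"
| "expr_val (Tail e) s = tail (expr_val e s)"
| "expr_val (Arith b e f) s = Atom (arith b (num_of (expr_val e s)) (num_of (expr_val f s)))"

fun expr_cost :: "cost_model \<Rightarrow> expr \<Rightarrow> store \<Rightarrow> nat" where
  "expr_cost m (Var v) s = 1"
| "expr_cost m Empty s = 1"
| "expr_cost m Zero s = 1"
| "expr_cost m One s = 1"
| "expr_cost m (MkPair e f) s = 1 + expr_cost m e s + expr_cost m f s"
| "expr_cost m (Head e) s = 1 + expr_cost m e s"
| "expr_cost m (Tail e) s = 1 + expr_cost m e s"
| "expr_cost m (Arith b e f) s = 1 + expr_cost m e s + expr_cost m f s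
     + num_size m (num_of (expr_val e s)) + num_size m (num_of (expr_val f s))
     + num_size m (num_of (expr_val (Arith b e f) s))"

fun cond_val :: "cond \<Rightarrow> store \<Rightarrow> bool" where
  "cond_val (IsPair e) s = (\<exists>l r. expr_val e s = Pair l r)"
| "cond_val (IsAtom e) s = (\<exists>x. expr_val e s = Atom x)"
| "cond_val (Leq e f) s = (num_of (expr_val e s) \<le> num_of (expr_val f s))"

fun cond_cost :: "cost_model \<Rightarrow> cond \<Rightarrow> store \<Rightarrow> nat" where
  "cond_cost m (IsPair e) s = 1 + expr_cost m e s"
| "cond_cost m (IsAtom e) s = 1 + expr_cost m e s"
| "cond_cost m (Leq e f) s = 1 + expr_cost m e s + expr_cost m f s
     + num_size m (num_of (expr_val e s)) + num_size m (num_of (expr_val f s))"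

text \<open>\<open>exec m c s k s'\<close>: started in \<open>s\<close>, the program \<open>c\<close> halts in \<open>s'\<close> after \<open>k\<close> time units.\<close>

inductive exec :: "cost_model \<Rightarrow> com \<Rightarrow> store \<Rightarrow> nat \<Rightarrow> store \<Rightarrow> bool" for m where
  exec_Skip: "exec m Skip s 1 s"
| exec_Assign: "exec m (Assign v e) s (1 + expr_cost m e s) (s(v := expr_val e s))"
| exec_Seq: "exec m c s k s' \<Longrightarrow> exec m c' s' k' s'' \<Longrightarrow> exec m (Seq c c') s (k + k') s''"
| exec_CondTrue: "cond_val b s \<Longrightarrow> exec m c s k s' \<Longrightarrow> exec m (Cond b c c') s (cond_cost m b s + k) s'"
| exec_CondFalse:
    "\<not> cond_val b s \<Longrightarrow> exec m c' s k s' \<Longrightarrow> exec m (Cond b c c') s (cond_cost m b s + k) s'"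
| exec_WhileFalse: "\<not> cond_val b s \<Longrightarrow> exec m (While b c) s (cond_cost m b s) s"
| exec_WhileTrue:
    "cond_val b s \<Longrightarrow> exec m c s k s' \<Longrightarrow> exec m (While b c) s' k' s''
     \<Longrightarrow> exec m (While b c) s (cond_cost m b s + k + k') s''"

text \<open>Variable \<open>0\<close> holds the input at the start and the output at the end.\<close>

definition outputs :: "cost_model \<Rightarrow> com \<Rightarrow> real sexp \<Rightarrow> nat \<Rightarrow> real sexp \<Rightarrow> bool" where
  "outputs m p inp k out \<longleftrightarrow> (\<exists>s. exec m p ((\<lambda>_. Emp)(0 := inp)) k s \<and> s 0 = out)"


section \<open>Graphs and the problem class\<close>

type_synonym graph = "nat set \<times> nat set set"

definition is_graph :: "graph \<Rightarrow> bool" where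
  "is_graph G \<longleftrightarrow> finite (fst G) \<and> (\<forall>e\<in>snd G. e \<subseteq> fst G \<and> card e = 2)"

definition subgraph_of :: "graph \<Rightarrow> graph \<Rightarrow> bool" where
  "subgraph_of G H \<longleftrightarrow> is_graph G \<and> fst G \<subseteq> fst H \<and> snd G \<subseteq> snd H"

text \<open>
  A problem maps the graph \<open>\<GG>\<close> and any further combinatorial data of the instance (terminals,
  parameters, \dots) to the family of feasible subgraphs.
\<close>

type_synonym problem = "graph \<Rightarrow> real sexp \<Rightarrow> graph set"

definition problem_class :: "problem set" where
  "problem_class = {P. \<forall>H x. is_graph H \<longrightarrow> (\<forall>G\<in>P H x. subgraph_of G H)}"

record 'p base_instance =
  host :: graph
  param :: "real sexp"
  points :: "'p set"
  distance :: "'p \<Rightarrow> 'p \<Rightarrow> real"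

record 'p nominal_instance = "'p base_instance" +
  position :: "nat \<Rightarrow> 'p"

record 'p robust_instance = "'p base_instance" +
  uncertainty :: "nat \<Rightarrow> 'p set"

definition feasible :: "problem \<Rightarrow> ('p, 'z) base_instance_scheme \<Rightarrow> graph set" where
  "feasible P I = P (host I) (param I)"

definition valid_base :: "problem \<Rightarrow> ('p, 'z) base_instance_scheme \<Rightarrow> bool" where
  "valid_base P I \<longleftrightarrow> is_graph (host I) \<and> feasible P I \<noteq> {} \<and> Metric_space (points I) (distance I)"

definition nominal_instances :: "problem \<Rightarrow> 'p nominal_instance set" where
  "nominal_instances P = {I. valid_base P I \<and> (\<forall>i\<in>fst (host I). position I i \<in> points I)}"

text \<open>
  \<open>\<M>\<close> is the collection of metric spaces in which the graph may be embedded: all of them, or a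
  particular one.
\<close>

definition robust_instances ::
    "problem \<Rightarrow> ('p set \<times> ('p \<Rightarrow> 'p \<Rightarrow> real)) set \<Rightarrow> 'p robust_instance set" where
  "robust_instances P \<M> = {I. valid_base P I \<and> (points I, distance I) \<in> \<M> \<and>
     (\<forall>i\<in>fst (host I). finite (uncertainty I i) \<and> uncertainty I i \<noteq> {} \<and>
        uncertainty I i \<subseteq> points I)}"

text \<open>An edge \<open>{i, j}\<close> is evaluated at \<open>(Min e, Max e)\<close>; all weights used are symmetric.\<close>

definition edge_sum :: "(nat \<Rightarrow> nat \<Rightarrow> real) \<Rightarrow> graph \<Rightarrow> real" where
  "edge_sum w G = (\<Sum>e\<in>snd G. w (Min e) (Max e))"

definition nominal_cost :: "'p nominal_instance \<Rightarrow> graph \<Rightarrow> real" where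
  "nominal_cost I = edge_sum (\<lambda>i j. distance I (position I i) (position I j))"

definition robust_cost :: "'p robust_instance \<Rightarrow> graph \<Rightarrow> real" where
  "robust_cost I G =
     Max ((\<lambda>u. edge_sum (\<lambda>i j. distance I (u i) (u j)) G) ` Pi\<^sub>E (fst (host I)) (uncertainty I))"

definition dist_max :: "'p robust_instance \<Rightarrow> nat \<Rightarrow> nat \<Rightarrow> real" where
  "dist_max I i j = Max {distance I p q | p q. p \<in> uncertainty I i \<and> q \<in> uncertainty I j}"

definition cost_max :: "'p robust_instance \<Rightarrow> graph \<Rightarrow> real" where
  "cost_max I = edge_sum (dist_max I)"


section \<open>Encoding of instances and solutions\<close>

fun enc_list :: "'a sexp list \<Rightarrow> 'a sexp" where
  "enc_list [] = Emp"
| "enc_list (x # xs) = Pair x (enc_list xs)"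

definition enc_nat :: "nat \<Rightarrow> real sexp" where
  "enc_nat n = Atom (real n)"

definition enc_graph :: "nat list \<Rightarrow> (nat \<times> nat) list \<Rightarrow> real sexp" where
  "enc_graph vs es =
     Pair (enc_list (map enc_nat vs)) (enc_list (map (\<lambda>(i, j). Pair (enc_nat i) (enc_nat j)) es))"

definition lists_graph :: "nat list \<Rightarrow> (nat \<times> nat) list \<Rightarrow> graph \<Rightarrow> bool" where
  "lists_graph vs es G \<longleftrightarrow> distinct vs \<and> set vs = fst G \<and>
     distinct (map (\<lambda>(i, j). {i, j}) es) \<and> set (map (\<lambda>(i, j). {i, j}) es) = snd G"

definition encodes_graph :: "graph \<Rightarrow> real sexp \<Rightarrow> bool" where
  "encodes_graph G t \<longleftrightarrow> (\<exists>vs es. lists_graph vs es G \<and> t = enc_graph vs es)"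

definition enc_matrix :: "('b \<Rightarrow> 'c \<Rightarrow> 'a sexp) \<Rightarrow> 'b list \<Rightarrow> 'c list \<Rightarrow> 'a sexp" where
  "enc_matrix f xs ys = enc_list (map (\<lambda>x. enc_list (map (f x) ys)) xs)"

text \<open>The positions are given through the matrix of their distances.\<close>

definition encodes_nominal :: "'p nominal_instance \<Rightarrow> real sexp \<Rightarrow> bool" where
  "encodes_nominal I t \<longleftrightarrow> (\<exists>vs es. lists_graph vs es (host I) \<and>
     t = Pair (enc_graph vs es) (Pair (param I)
       (enc_matrix (\<lambda>i j. Atom (distance I (position I i) (position I j))) vs vs)))"

text \<open>
  The uncertainty sets are given through the matrix of the distances between all possible
  positions, divided into one block for each pair of vertices.
\<close>

definition encodes_robust :: "'p robust_instance \<Rightarrow> real sexp \<Rightarrow> bool" where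
  "encodes_robust I t \<longleftrightarrow> (\<exists>vs es L. lists_graph vs es (host I) \<and>
     (\<forall>i\<in>set vs. distinct (L i) \<and> set (L i) = uncertainty I i) \<and>
     t = Pair (enc_graph vs es) (Pair (param I)
       (enc_matrix (\<lambda>i j. enc_matrix (\<lambda>p q. Atom (distance I p q)) (L i) (L j)) vs vs)))"


section \<open>Approximation algorithms\<close>

text \<open>
  \<open>insts\<close>, \<open>enc\<close>, \<open>feas\<close> and \<open>cst\<close> are the instances, their encodings, the feasible
  solutions and the objective of a minimisation problem.
\<close>

definition polynomial_approximation ::
    "cost_model \<Rightarrow> 'i set \<Rightarrow> ('i \<Rightarrow> real sexp \<Rightarrow> bool) \<Rightarrow> ('i \<Rightarrow> graph set) \<Rightarrow>
     ('i \<Rightarrow> graph \<Rightarrow> real) \<Rightarrow> real \<Rightarrow> com \<Rightarrow> bool" where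
  "polynomial_approximation m insts enc feas cst \<rho> p \<longleftrightarrow>
     (\<exists>q :: nat poly. \<forall>I\<in>insts. \<forall>t. enc I t \<and> set_sexp t \<subseteq> numbers m \<longrightarrow>
        (\<exists>k out G. outputs m p t k out \<and> k \<le> poly q (input_size m t) \<and>
           encodes_graph G out \<and> G \<in> feas I \<and> cst I G \<le> \<rho> * Min (cst I ` feas I)))"

text \<open>
  The points of nominal instances are taken from \<^typ>\<open>nat\<close>: only the finitely many positions of
  the vertices matter, so every instance over another metric space is isometric to one of these.
\<close>

definition approximates_problem :: "cost_model \<Rightarrow> problem \<Rightarrow> real \<Rightarrow> com \<Rightarrow> bool" where
  "approximates_problem m P \<rho> p \<longleftrightarrow>
     polynomial_approximation m (nominal_instances P :: nat nominal_instance set)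
       encodes_nominal (feasible P) nominal_cost \<rho> p"

definition approximates_robust ::
    "cost_model \<Rightarrow> problem \<Rightarrow> ('p set \<times> ('p \<Rightarrow> 'p \<Rightarrow> real)) set \<Rightarrow> real \<Rightarrow> com \<Rightarrow> bool" where
  "approximates_robust m P \<M> \<rho> p \<longleftrightarrow>
     polynomial_approximation m (robust_instances P \<M>)
       encodes_robust (feasible P) robust_cost \<rho> p"

text \<open>
  \<open>J\<close> is the instance \<open>min cost_max\<close> of the nominal problem. The worst-case distances need only
  be realised between distinct vertices: \<open>dist_max I i i\<close> is the diameter of the \<open>i\<close>-th
  uncertainty set, which may be positive, but no edge uses it.
\<close>

definition worst_case_instance :: "'p robust_instance \<Rightarrow> 'r nominal_instance \<Rightarrow> bool" where
  "worst_case_instance I J \<longleftrightarrow> host J = host I \<and> param J = param I \<and>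
     (\<forall>i\<in>fst (host I). \<forall>j\<in>fst (host I). i \<noteq> j \<longrightarrow>
        distance J (position J i) (position J j) = dist_max I i j)"

text \<open>\<open>B\<close> returns the output of \<open>A\<close> on the instance with worst-case distances.\<close>

definition applies_to_worst_case ::
    "cost_model \<Rightarrow> problem \<Rightarrow> ('p set \<times> ('p \<Rightarrow> 'p \<Rightarrow> real)) set \<Rightarrow> com \<Rightarrow> com \<Rightarrow> bool" where
  "applies_to_worst_case m P \<M> A B \<longleftrightarrow>
     (\<forall>I\<in>robust_instances P \<M>. \<forall>t. encodes_robust I t \<and> set_sexp t \<subseteq> numbers m \<longrightarrow>
        (\<exists>J \<in> (nominal_instances P :: nat nominal_instance set). \<exists>t'.
           worst_case_instance I J \<and> encodes_nominal J t' \<and> set_sexp t' \<subseteq> numbers m \<and>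
           (\<forall>out. (\<exists>k. outputs m B t k out) \<longleftrightarrow> (\<exists>k. outputs m A t' k out))))"

end

theory Submission
  imports Defs
begin

text \<open>
  On every feasible graph the robust cost \<open>c\<close> satisfies \<open>c \<le> c\<^sup>m\<^sup>a\<^sup>x \<le> \<rho>\<^sub>2 c\<close>, so a \<open>\<rho>\<^sub>1\<close>-approximate
  minimiser of \<open>c\<^sup>m\<^sup>a\<^sup>x\<close> is a \<open>\<rho>\<^sub>1 \<rho>\<^sub>2\<close>-approximate minimiser of \<open>c\<close>. The worst-case distances between
  distinct vertices, with \<open>0\<close> on the diagonal, form a pseudometric, and identifying vertices at
  distance zero turns it into a metric. The matrix is computed by taking the maximum of each block
  of the input, which only compares and copies input numbers; hence this takes polynomial time in
  both cost models and the new input is no longer than the old one.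
\<close>

section \<open>Execution of programs\<close>

text \<open>Needed because \<open>applies_to_worst_case\<close> is an equivalence: every output of a
  composed program must come from the one possible run of its first half.\<close>

lemma exec_deterministic:
  "exec m c s k s' \<Longrightarrow> exec m c s l s'' \<Longrightarrow> l = k \<and> s'' = s'"
proof (induction arbitrary: l s'' rule: exec.induct)
  case (exec_Skip s)
  then show ?case by (auto elim: exec.cases)
next
  case (exec_Assign v e s)
  then show ?case by (auto elim: exec.cases)
next
  case (exec_Seq c s k s' c' k' s2)
  from exec_Seq.prems show ?case
    by (cases rule: exec.cases) (use exec_Seq.IH in blast)+
next
  case (exec_CondTrue b s c k s' c')
  from exec_CondTrue.prems show ?case
    by (cases rule: exec.cases) (use exec_CondTrue.IH exec_CondTrue.hyps in blast)+
next
  case (exec_CondFalse b s c' k s' c)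
  from exec_CondFalse.prems show ?case
    by (cases rule: exec.cases) (use exec_CondFalse.IH exec_CondFalse.hyps in blast)+
next
  case (exec_WhileFalse b s c)
  from exec_WhileFalse.prems show ?case
    by (cases rule: exec.cases) (use exec_WhileFalse.hyps in blast)+
next
  case (exec_WhileTrue b s c k s' k' s2)
  from exec_WhileTrue.prems show ?case
    by (cases rule: exec.cases) (use exec_WhileTrue.IH exec_WhileTrue.hyps in blast)+
qed

text \<open>Exact costs depend on the numbers compared. An upper bound can be padded by
  \<open>runs_mono\<close>, so that the branches of a conditional and the rounds of a loop share one
  bound.\<close>

definition runs :: "cost_model \<Rightarrow> com \<Rightarrow> store \<Rightarrow> nat \<Rightarrow> store \<Rightarrow> bool" where
  "runs m c s n s' \<longleftrightarrow> (\<exists>k\<le>n. exec m c s k s')"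

lemma runs_mono: "runs m c s n s' \<Longrightarrow> n \<le> n' \<Longrightarrow> runs m c s n' s'"
  unfolding runs_def by (meson order_trans)

lemma runs_Skip: "runs m Skip s 1 s"
  unfolding runs_def using exec_Skip by blast

lemma runs_Assign: "s' = s(v := expr_val e s) \<Longrightarrow> runs m (Assign v e) s (1 + expr_cost m e s) s'"
  unfolding runs_def using exec_Assign by blast

lemma runs_Seq: "runs m c s a s' \<Longrightarrow> runs m c' s' b s'' \<Longrightarrow> runs m (Seq c c') s (a + b) s''"
  unfolding runs_def by (meson add_mono exec_Seq)

lemma runs_Cond:
  "runs m (if cond_val b s then c else c') s n s' \<Longrightarrow>
   runs m (Cond b c c') s (cond_cost m b s + n) s'"
  unfolding runs_def by (metis add_left_mono exec_CondFalse exec_CondTrue)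

text \<open>Loop rule for programs that consume a list. \<open>st\<close> gives the store as a
  function of the unread part and the accumulator, and \<open>R\<close> is an invariant of the
  accumulator. The guard costs 2, once per round and once at the end.\<close>

lemma runs_While_fold:
  assumes step: "\<And>x xs a. x \<in> X \<Longrightarrow> a \<in> R \<Longrightarrow>
      f x a \<in> R \<and> runs m c (st (x # xs) a) C (st xs (f x a))"
    and guard: "\<And>xs a. st xs a v = enc_list (map h xs)"
  shows "set xs \<subseteq> X \<Longrightarrow> a \<in> R \<Longrightarrow> length xs \<le> L \<Longrightarrow>
    runs m (While (IsPair (Var v)) c) (st xs a) (2 + L * (C + 2)) (st [] (fold f xs a))"
proof (induction xs arbitrary: a L)
  case Nil
  have "exec m (While (IsPair (Var v)) c) (st [] a) (cond_cost m (IsPair (Var v)) (st [] a)) (st [] a)"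
    by (rule exec_WhileFalse) (simp add: guard)
  then show ?case unfolding runs_def by (intro exI[of _ 2]) (simp add: numeral_2_eq_2)
next
  case (Cons x xs)
  from step[of x a xs] Cons.prems have R: "f x a \<in> R"
    and b: "runs m c (st (x # xs) a) C (st xs (f x a))" by auto
  from b obtain k where k: "k \<le> C" "exec m c (st (x # xs) a) k (st xs (f x a))"
    unfolding runs_def by blast
  obtain L' where L': "L = Suc L'" "length xs \<le> L'"
    using Cons.prems(3) by (cases L) auto
  from Cons.IH[OF _ R L'(2)] Cons.prems obtain l where l: "l \<le> 2 + L' * (C + 2)"
    "exec m (While (IsPair (Var v)) c) (st xs (f x a)) l (st [] (fold f xs (f x a)))"
    unfolding runs_def by auto
  have "exec m (While (IsPair (Var v)) c) (st (x # xs) a)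
      (cond_cost m (IsPair (Var v)) (st (x # xs) a) + k + l) (st [] (fold f xs (f x a)))"
    by (rule exec_WhileTrue[OF _ k(2) l(2)]) (simp add: guard)
  then show ?case unfolding runs_def
    using k(1) l(1) L'(1) by (intro exI[of _ "2 + k + l"]) simp
qed

section \<open>Computing the worst-case distance matrix\<close>

text \<open>Variable 10 holds the unread part of a row, 9 that of a block, and 8 the running
  maximum.\<close>

definition row_max_prog :: com where
  "row_max_prog = While (IsPair (Var 10))
     (Seq (Cond (Leq (Var 8) (Head (Var 10))) (Assign 8 (Head (Var 10))) Skip)
       (Assign 10 (Tail (Var 10))))"

definition block_max_prog :: com where
  "block_max_prog = While (IsPair (Var 9))
     (Seq (Assign 10 (Head (Var 9))) (Seq row_max_prog (Assign 9 (Tail (Var 9)))))"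

text \<open>Variables 5 and 6 hold the unread column vertices and blocks, 7 the entries found so
  far. Vertices are tested for equality by two \<open>Leq\<close>; on the diagonal the block is
  dropped, so that the initial 0 in variable 8 becomes the entry.\<close>

definition entry_prog :: com where
  "entry_prog =
     Seq (Assign 8 Zero) (Seq (Assign 9 (Head (Var 6)))
    (Seq (Cond (Leq (Head (Var 5)) (Head (Var 1)))
            (Cond (Leq (Head (Var 1)) (Head (Var 5))) (Assign 9 Empty) block_max_prog)
            block_max_prog)
    (Seq (Assign 7 (MkPair (Var 8) (Var 7)))
    (Seq (Assign 8 Empty)
    (Seq (Assign 6 (Tail (Var 6))) (Assign 5 (Tail (Var 5))))))))"

text \<open>Variables 1 and 2 hold the unread row vertices and rows of blocks, 3 and 4 the vertices
  and rows of the output.\<close>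

definition row_prog :: com where
  "row_prog =
     Seq (Assign 5 (Head (Head (Var 0)))) (Seq (Assign 6 (Head (Var 2)))
    (Seq (While (IsPair (Var 5)) entry_prog)
    (Seq (Assign 3 (MkPair (Head (Var 1)) (Var 3)))
    (Seq (Assign 4 (MkPair (Var 7) (Var 4)))
    (Seq (Assign 7 Empty)
    (Seq (Assign 2 (Tail (Var 2))) (Assign 1 (Tail (Var 1)))))))))"

text \<open>
  The vertices and the entries are consed in the order in which they are read, so the new instance
  lists the vertices in reverse order. All auxiliary variables are empty again at the end.
\<close>

definition worst_case_prog :: com where
  "worst_case_prog =
     Seq (Assign 1 (Head (Head (Var 0)))) (Seq (Assign 2 (Tail (Tail (Var 0))))
    (Seq (While (IsPair (Var 1)) row_prog)
    (Seq (Assign 0 (MkPair (MkPair (Var 3) (Tail (Head (Var 0)))) (MkPair (Head (Tail (Var 0))) (Var 4))))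
    (Seq (Assign 3 Empty) (Assign 4 Empty)))))"

section \<open>Functional counterparts of the programs and their running times\<close>

definition enc_block :: "real list list \<Rightarrow> real sexp" where
  "enc_block b = enc_list (map (\<lambda>r. enc_list (map Atom r)) b)"

definition block_max :: "real list list \<Rightarrow> real" where
  "block_max b = fold (fold max) b 0"

text \<open>A diagonal block has the diameter of one uncertainty set as its maximum, whereas a
  distance matrix needs 0 there.\<close>

definition entry :: "(nat \<Rightarrow> nat \<Rightarrow> real list list) \<Rightarrow> nat \<Rightarrow> nat \<Rightarrow> real" where
  "entry b i j = (if i = j then 0 else block_max (b i j))"

text \<open>Maxima create no new numbers, so the size of the accumulator stays bounded by the sizes
  of the numbers read and of the initial value.\<close>

lemma fold_max_mem: "fold max xs (a::real) \<in> insert a (set xs)"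
proof (induction xs arbitrary: a)
  case (Cons x xs)
  from Cons.IH[of "max x a"] show ?case by (auto simp: max_def split: if_splits)
qed simp

lemma runs_row_max_prog:
  assumes N: "\<forall>x\<in>set xs. num_size m x \<le> N" "num_size m a \<le> N" and len: "length xs \<le> N"
  shows "runs m row_max_prog (s(10 := enc_list (map Atom xs), 8 := Atom a)) (2 + N * (2 * N + 10 + 2))
    (s(10 := Emp, 8 := Atom (fold max xs a)))"
proof -
  let ?st = "\<lambda>xs a. s(10 := enc_list (map Atom xs), 8 := Atom a)"
  have "runs m row_max_prog (?st xs a) (2 + N * (2 * N + 10 + 2)) (?st [] (fold max xs a))"
    unfolding row_max_prog_def
  proof (rule runs_While_fold[where X = "{x. num_size m x \<le> N}" and R = "{x. num_size m x \<le> N}"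
        and h = Atom])
    fix x a xs assume x: "x \<in> {x. num_size m x \<le> N}" and a: "a \<in> {x. num_size m x \<le> N}"
    \<comment> \<open>The comparison costs 4 plus both number sizes; each assignment costs 3, and
      the branch \<open>Skip\<close> is padded to 3.\<close>
    have "runs m (Seq (Cond (Leq (Var 8) (Head (Var 10))) (Assign 8 (Head (Var 10))) Skip)
       (Assign 10 (Tail (Var 10)))) (?st (x # xs) a) (((4 + num_size m a + num_size m x) + 3) + 3)
        (?st xs (max x a))"
    proof (rule runs_Seq)
      let ?s = "(?st (x # xs) a)(8 := Atom (max x a))"
      have "runs m (if a \<le> x then Assign 8 (Head (Var 10)) else Skip) (?st (x # xs) a) 3 ?s"
        using runs_Assign[of ?s "?st (x # xs) a" 8 "Head (Var 10)" m]
          runs_mono[OF runs_Skip, of 3 m "?st (x # xs) a"]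
        by (auto simp: max_def fun_upd_twist numeral_3_eq_3)
      then show "runs m (Cond (Leq (Var 8) (Head (Var 10))) (Assign 8 (Head (Var 10))) Skip)
          (?st (x # xs) a) ((4 + num_size m a + num_size m x) + 3) ?s"
        using runs_Cond[of m "Leq (Var 8) (Head (Var 10))" "?st (x # xs) a" "Assign 8 (Head (Var 10))" Skip 3 ?s]
        by (simp add: ac_simps)
      show "runs m (Assign 10 (Tail (Var 10))) ?s 3 (?st xs (max x a))"
        using runs_Assign[of "?st xs (max x a)" ?s 10 "Tail (Var 10)" m]
        by (auto simp: fun_upd_twist numeral_3_eq_3)
    qed
    then have "runs m (Seq (Cond (Leq (Var 8) (Head (Var 10))) (Assign 8 (Head (Var 10))) Skip)
       (Assign 10 (Tail (Var 10)))) (?st (x # xs) a) (2 * N + 10) (?st xs (max x a))"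
      by (rule runs_mono) (use x a in auto)
    then show "max x a \<in> {x. num_size m x \<le> N} \<and> runs m
       (Seq (Cond (Leq (Var 8) (Head (Var 10))) (Assign 8 (Head (Var 10))) Skip)
       (Assign 10 (Tail (Var 10)))) (?st (x # xs) a) (2 * N + 10) (?st xs (max x a))"
      using x a by (auto simp: max_def)
  qed (use N len in auto)
  then show ?thesis by simp
qed

lemma runs_block_max_prog:
  assumes N: "\<forall>r\<in>set b. length r \<le> N \<and> (\<forall>x\<in>set r. num_size m x \<le> N)" "num_size m 0 \<le> N"
    and len: "length b \<le> N" and s: "s 8 = Atom 0" "s 9 = enc_block b" "s 10 = Emp"
  shows "runs m block_max_prog s
      (2 + N * (N * (2 * N + 10 + 2) + 8 + 2)) (s(9 := Emp, 8 := Atom (block_max b)))"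
proof -
  let ?st = "\<lambda>b a. s(9 := enc_block b, 8 := Atom a)"
  let ?X = "{r. length r \<le> N \<and> (\<forall>x\<in>set r. num_size m x \<le> N)}"
  have "runs m block_max_prog (?st b 0) (2 + N * (N * (2 * N + 10 + 2) + 8 + 2))
      (?st [] (fold (fold max) b 0))"
    unfolding block_max_prog_def
  proof (rule runs_While_fold[where X = ?X and R = "{x. num_size m x \<le> N}"
        and h = "\<lambda>r. enc_list (map Atom r)"])
    fix r a b assume r: "r \<in> ?X" and a: "a \<in> {x. num_size m x \<le> N}"
    let ?s = "s(9 := enc_block (r # b))"
    have "runs m (Seq (Assign 10 (Head (Var 9))) (Seq row_max_prog (Assign 9 (Tail (Var 9)))))
      (?st (r # b) a) (3 + ((2 + N * (2 * N + 10 + 2)) + 3)) (?st b (fold max r a))"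
    proof (intro runs_Seq)
      show "runs m (Assign 10 (Head (Var 9))) (?st (r # b) a) 3
          (?s(10 := enc_list (map Atom r), 8 := Atom a))"
        using runs_Assign[of "?s(10 := enc_list (map Atom r), 8 := Atom a)" "?st (r # b) a" 10 "Head (Var 9)" m]
        by (auto simp: fun_upd_twist numeral_3_eq_3 enc_block_def)
      show "runs m row_max_prog (?s(10 := enc_list (map Atom r), 8 := Atom a)) (2 + N * (2 * N + 10 + 2))
          (?s(10 := Emp, 8 := Atom (fold max r a)))"
        by (rule runs_row_max_prog) (use r a in auto)
      \<comment> \<open>The row scan leaves variable 10 empty, as it is in \<open>s\<close>, so the
        store has the form \<open>?st\<close> again.\<close>
      show "runs m (Assign 9 (Tail (Var 9))) (?s(10 := Emp, 8 := Atom (fold max r a))) 3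
          (?st b (fold max r a))"
        using runs_Assign[of "?st b (fold max r a)" "?s(10 := Emp, 8 := Atom (fold max r a))" 9 "Tail (Var 9)" m] s
        by (auto simp: fun_eq_iff numeral_3_eq_3 enc_block_def)
    qed
    moreover have "num_size m (fold max r a) \<le> N"
      using fold_max_mem[of r a] r a by auto
    ultimately show "fold max r a \<in> {x. num_size m x \<le> N} \<and> runs m
       (Seq (Assign 10 (Head (Var 9))) (Seq row_max_prog (Assign 9 (Tail (Var 9)))))
      (?st (r # b) a) (N * (2 * N + 10 + 2) + 8) (?st b (fold max r a))"
      by (simp add: ac_simps)
  qed (use N len in \<open>auto simp: enc_block_def\<close>)
  moreover have "?st b 0 = s" using s by (simp add: fun_eq_iff)
  ultimately show ?thesis by (simp add: enc_block_def block_max_def)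
qed

definition bounded_block :: "cost_model \<Rightarrow> nat \<Rightarrow> real list list \<Rightarrow> bool" where
  "bounded_block m N b \<longleftrightarrow>
     length b \<le> N \<and> (\<forall>r\<in>set b. length r \<le> N \<and> (\<forall>x\<in>set r. num_size m x \<le> N))"

text \<open>The first product pays for scanning a block, \<open>4 * N\<close> for the two
  comparisons of vertex numbers, and 40 for the remaining constant costs.\<close>

definition entry_time :: "nat \<Rightarrow> nat" where
  "entry_time N = N * (N * (2 * N + 10 + 2) + 8 + 2) + 4 * N + 40"

lemma runs_entry_prog:
  assumes i: "s 1 = Pair (enc_nat i) r" "num_size m (real i) \<le> N"
    and j: "s 5 = Pair (enc_nat j) r'" "num_size m (real j) \<le> N"
    and b: "s 6 = Pair (enc_block (b i j)) r''" "bounded_block m N (b i j)"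
    and N: "num_size m 0 \<le> N" and s: "s 8 = Emp" "s 9 = Emp" "s 10 = Emp"
  shows "runs m entry_prog s (entry_time N)
    (s(5 := r', 6 := r'', 7 := Pair (Atom (entry b i j)) (s 7)))"
proof -
  let ?T = "2 + N * (N * (2 * N + 10 + 2) + 8 + 2)"
  let ?s = "s(8 := Atom 0, 9 := enc_block (b i j))"
  let ?s' = "s(8 := Atom (entry b i j))"
  let ?c = "Cond (Leq (Head (Var 1)) (Head (Var 5))) (Assign 9 Empty) block_max_prog"
  have upd: "s(9 := Emp) = s"
    using s by (simp add: fun_eq_iff)
  have B: "runs m block_max_prog ?s ?T (s(8 := Atom (block_max (b i j))))"
    using runs_block_max_prog[of "b i j" N m ?s] b N s by (simp add: bounded_block_def upd)
  \<comment> \<open>Dropping the block gets the same time bound as scanning it, since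
    \<open>runs_Cond\<close> asks for one bound.\<close>
  have E: "runs m (Assign 9 Empty) ?s ?T (s(8 := Atom 0))"
    by (rule runs_mono[OF runs_Assign]) (use s in \<open>auto simp: fun_eq_iff\<close>)
  have "runs m ?c ?s (cond_cost m (Leq (Head (Var 1)) (Head (Var 5))) ?s + ?T) ?s'" if "j \<le> i"
    by (rule runs_Cond) (use B E i j that in \<open>auto simp: enc_nat_def entry_def\<close>)
  then have c: "runs m ?c ?s (5 + 2 * N + ?T) ?s'" if "j \<le> i"
    by (rule runs_mono) (use that i j in \<open>auto simp: enc_nat_def\<close>)
  have B': "runs m block_max_prog ?s (5 + 2 * N + ?T) (s(8 := Atom (block_max (b i j))))"
    by (rule runs_mono[OF B]) simp
  have "runs m (Cond (Leq (Head (Var 5)) (Head (Var 1))) ?c block_max_prog) ?s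
      (cond_cost m (Leq (Head (Var 5)) (Head (Var 1))) ?s + (5 + 2 * N + ?T)) ?s'"
    by (rule runs_Cond) (use B' c i j in \<open>auto simp: enc_nat_def entry_def\<close>)
  then have C: "runs m (Cond (Leq (Head (Var 5)) (Head (Var 1))) ?c block_max_prog) ?s
      (5 + 2 * N + (5 + 2 * N + ?T)) ?s'"
    by (rule runs_mono) (use i j in \<open>auto simp: enc_nat_def\<close>)
  have S: "s(8 := expr_val Zero s, 9 := expr_val (Head (Var 6)) (s(8 := expr_val Zero s))) = ?s"
    using b by simp
  show ?thesis
    unfolding entry_prog_def
    \<comment> \<open>The time bound becomes schematic and is instantiated by composing the single
      steps; simplification then compares it with \<open>entry_time N\<close>. \<open>S\<close>
      brings the store into the form for which \<open>C\<close> is stated.\<close>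
    apply (rule runs_mono)
     apply (rule runs_Seq[OF runs_Assign[OF refl]])
     apply (rule runs_Seq[OF runs_Assign[OF refl]])
     apply (rule runs_Seq)
      apply (subst S, rule C)
     apply (rule runs_Seq[OF runs_Assign[OF refl]])+
     apply (rule runs_Assign)
     apply (simp_all add: b i j s entry_time_def)
    apply (simp add: fun_eq_iff s)
    done
qed

lemma runs_row_prog:
  assumes i: "s 1 = Pair (enc_nat i) r" "i \<in> set vs"
    and g: "s 0 = Pair (Pair (enc_list (map enc_nat vs)) es) z"
    and rows: "s 2 = Pair (enc_list (map (\<lambda>j. enc_block (b i j)) vs)) r'"
    and V: "\<forall>j\<in>set vs. num_size m (real j) \<le> N \<and> bounded_block m N (b i j)" "length vs \<le> N"
    and N: "num_size m 0 \<le> N" and s: "\<forall>v\<in>{5..10}. s v = Emp"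
  shows "runs m row_prog s (N * (entry_time N + 2) + 40)
    (s(1 := r, 2 := r', 3 := Pair (enc_nat i) (s 3),
       4 := Pair (enc_list (map (\<lambda>j. Atom (entry b i j)) (rev vs))) (s 4)))"
proof -
  have s': "s 5 = Emp" "s 6 = Emp" "s 7 = Emp" "s 8 = Emp" "s 9 = Emp" "s 10 = Emp"
    using s by auto
  let ?st = "\<lambda>ws ys. s(5 := enc_list (map enc_nat ws),
    6 := enc_list (map (\<lambda>j. enc_block (b i j)) ws), 7 := enc_list (map (\<lambda>j. Atom (entry b i j)) ys))"
  \<comment> \<open>The accumulator lists the columns already treated;
    \<open>fold Cons vs []\<close> is \<open>rev vs\<close>.\<close>
  have L: "runs m (While (IsPair (Var 5)) entry_prog) (?st vs []) (2 + N * (entry_time N + 2))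
      (?st [] (fold Cons vs []))"
  proof (rule runs_While_fold[where X = "set vs" and R = UNIV and h = enc_nat])
    fix j ws and ys :: "nat list" assume j: "j \<in> set vs"
    have "runs m entry_prog (?st (j # ws) ys) (entry_time N)
      ((?st (j # ws) ys)(5 := enc_list (map enc_nat ws), 6 := enc_list (map (\<lambda>j. enc_block (b i j)) ws),
        7 := Pair (Atom (entry b i j)) (?st (j # ws) ys 7)))"
      by (rule runs_entry_prog[of _ i r m N j _ b]) (use i V N s' j in auto)
    moreover have "(?st (j # ws) ys)(5 := enc_list (map enc_nat ws), 6 := enc_list (map (\<lambda>j. enc_block (b i j)) ws),
        7 := Pair (Atom (entry b i j)) (?st (j # ws) ys 7)) = ?st ws (j # ys)"
      by (simp add: fun_eq_iff)
    ultimately show "j # ys \<in> UNIV \<and> runs m entry_prog (?st (j # ws) ys) (entry_time N) (?st ws (j # ys))"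
      by simp
  qed (use V in auto)
  have S: "s(5 := expr_val (Head (Head (Var 0))) s,
      6 := expr_val (Head (Var 2)) (s(5 := expr_val (Head (Head (Var 0))) s))) = ?st vs []"
    using g rows s' by (simp add: fun_eq_iff)
  show ?thesis
    unfolding row_prog_def
    apply (rule runs_mono)
     apply (rule runs_Seq[OF runs_Assign[OF refl]])
     apply (rule runs_Seq[OF runs_Assign[OF refl]])
     apply (rule runs_Seq)
      apply (subst S, rule L)
     apply (rule runs_Seq[OF runs_Assign[OF refl]])+
     apply (rule runs_Assign)
     apply (simp_all add: i[simplified] rows s' fold_Cons_rev)
    apply (simp add: fun_eq_iff s')
    done
qed

text \<open>\<open>es\<close> and \<open>y\<close> are arbitrary, as edges and parameter are copied
  unread. Vertices, rows and columns are all reversed, so the matrix still matches the vertex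
  list.\<close>

lemma runs_worst_case_prog:
  assumes V: "\<forall>j\<in>set vs. num_size m (real j) \<le> N" "\<forall>i\<in>set vs. \<forall>j\<in>set vs. bounded_block m N (b i j)"
      "length vs \<le> N" and N: "num_size m 0 \<le> N"
  shows "runs m worst_case_prog
    ((\<lambda>_. Emp)(0 := Pair (Pair (enc_list (map enc_nat vs)) es)
       (Pair y (enc_matrix (\<lambda>i j. enc_block (b i j)) vs vs))))
    (N * (N * (entry_time N + 2) + 40 + 2) + 40)
    ((\<lambda>_. Emp)(0 := Pair (Pair (enc_list (map enc_nat (rev vs))) es)
       (Pair y (enc_matrix (\<lambda>i j. Atom (entry b i j)) (rev vs) (rev vs)))))"
    (is "runs m _ ?s ?T ?s'")
proof -
  let ?row = "\<lambda>i. enc_list (map (\<lambda>j. enc_block (b i j)) vs)"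
  let ?out = "\<lambda>i. enc_list (map (\<lambda>j. Atom (entry b i j)) (rev vs))"
  let ?st = "\<lambda>ws ys. ?s(1 := enc_list (map enc_nat ws), 2 := enc_list (map ?row ws),
    3 := enc_list (map enc_nat ys), 4 := enc_list (map ?out ys))"
  have L: "runs m (While (IsPair (Var 1)) row_prog) (?st vs []) (2 + N * (N * (entry_time N + 2) + 40 + 2))
      (?st [] (fold Cons vs []))"
  proof (rule runs_While_fold[where X = "set vs" and R = UNIV and h = enc_nat])
    fix i ws and ys :: "nat list" assume i: "i \<in> set vs"
    let ?t = "?st (i # ws) ys"
    let ?t' = "?t(1 := enc_list (map enc_nat ws), 2 := enc_list (map ?row ws),
      3 := Pair (enc_nat i) (?t 3), 4 := Pair (?out i) (?t 4))"
    have "runs m row_prog ?t (N * (entry_time N + 2) + 40) ?t'"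
      by (rule runs_row_prog[where es = es and z = "Pair y (enc_matrix (\<lambda>i j. enc_block (b i j)) vs vs)"])
        (use V N i in auto)
    moreover have "?t' = ?st ws (i # ys)"
      by (simp add: fun_eq_iff)
    ultimately show "i # ys \<in> UNIV \<and> runs m row_prog ?t (N * (entry_time N + 2) + 40) (?st ws (i # ys))"
      by simp
  qed (use V in auto)
  have S: "?s(1 := expr_val (Head (Head (Var 0))) ?s,
      2 := expr_val (Tail (Tail (Var 0))) (?s(1 := expr_val (Head (Head (Var 0))) ?s))) = ?st vs []"
    by (simp add: fun_eq_iff enc_matrix_def)
  show ?thesis
    unfolding worst_case_prog_def
    apply (rule runs_mono)
     apply (rule runs_Seq[OF runs_Assign[OF refl]])
     apply (rule runs_Seq[OF runs_Assign[OF refl]])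
     apply (rule runs_Seq)
      apply (subst S, rule L)
     apply (rule runs_Seq[OF runs_Assign[OF refl]])+
     apply (rule runs_Assign)
     apply (simp_all add: fold_Cons_rev enc_matrix_def)
    apply (simp add: fun_eq_iff)
    done
qed

section \<open>Input sizes\<close>

text \<open>0 is the only number in the new instance that may be absent from the old one; as the
  fraction 0/1 it has bit length 0 + 1.\<close>

lemma num_size_zero: "num_size m 0 = 1"
proof -
  have "inv (of_rat :: rat \<Rightarrow> real) 0 = 0"
    using inv_f_f[of "of_rat :: rat \<Rightarrow> real" 0] by (simp add: inj_def)
  then show ?thesis by (cases m) (simp_all add: compute_bitlen[of 1])
qed

text \<open>The denominator given by \<open>quotient_of\<close> is positive and so has at least one
  bit, whichever rational \<open>inv of_rat x\<close> denotes.\<close>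

lemma num_size_pos: "1 \<le> num_size m x"
proof (cases m)
  case Bit_Model
  obtain a b where ab: "quotient_of (inv of_rat x) = (a, b)" by fastforce
  then have "b > 0" by (rule quotient_of_denom_pos)
  then have "nat (bitlen b) \<ge> 1"
    using bitlen_eq_zero_iff[of b] bitlen_nonneg[of b] by linarith
  then show ?thesis using Bit_Model ab by simp
qed simp

lemma input_size_pos: "1 \<le> input_size m t"
  by (cases t) (use num_size_pos in auto)

lemma input_size_enc_list: "input_size m (enc_list xs) = 1 + (\<Sum>x\<leftarrow>xs. 1 + input_size m x)"
  by (induction xs) auto

lemma input_size_enc_list_mem: "x \<in> set xs \<Longrightarrow> input_size m x \<le> input_size m (enc_list xs)"
  by (induction xs) auto

lemma length_le_input_size: "length xs \<le> input_size m (enc_list xs)"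
  by (induction xs) auto

lemma num_size_le_input_size: "x \<in> set_sexp t \<Longrightarrow> num_size m x \<le> input_size m t"
  by (induction t) auto

lemma set_sexp_enc_list: "set_sexp (enc_list xs) = (\<Union>x\<in>set xs. set_sexp x)"
  by (induction xs) auto

lemma set_sexp_enc_block: "set_sexp (enc_block b) = (\<Union>r\<in>set b. set r)"
  by (simp add: enc_block_def set_sexp_enc_list)

lemma set_sexp_enc_matrix:
  "set_sexp (enc_matrix f xs ys) = (\<Union>x\<in>set xs. \<Union>y\<in>set ys. set_sexp (f x y))"
  by (simp add: enc_matrix_def set_sexp_enc_list)

lemma bounded_block_input_size: "bounded_block m (input_size m (enc_block b)) b"
  unfolding bounded_block_def
proof (intro conjI ballI)
  show "length b \<le> input_size m (enc_block b)"
    using length_le_input_size[of "map (\<lambda>r. enc_list (map Atom r)) b" m] by (simp add: enc_block_def)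
  fix r assume r: "r \<in> set b"
  have "length r \<le> input_size m (enc_list (map Atom r))"
    using length_le_input_size[of "map Atom r" m] by simp
  also have "\<dots> \<le> input_size m (enc_block b)"
    unfolding enc_block_def by (rule input_size_enc_list_mem) (use r in auto)
  finally show "length r \<le> input_size m (enc_block b)" .
  fix x assume "x \<in> set r"
  then show "num_size m x \<le> input_size m (enc_block b)"
    using r by (intro num_size_le_input_size) (auto simp: set_sexp_enc_block)
qed

lemma bounded_block_mono: "bounded_block m N b \<Longrightarrow> N \<le> N' \<Longrightarrow> bounded_block m N' b"
  unfolding bounded_block_def by (meson order_trans)

lemma input_size_enc_matrix_mem:
  assumes "x \<in> set xs" "y \<in> set ys"
  shows "input_size m (f x y) \<le> input_size m (enc_matrix f xs ys)"
proof -
  have "input_size m (f x y) \<le> input_size m (enc_list (map (f x) ys))"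
    by (rule input_size_enc_list_mem) (use assms in auto)
  also have "\<dots> \<le> input_size m (enc_matrix f xs ys)"
    unfolding enc_matrix_def by (rule input_size_enc_list_mem) (use assms in auto)
  finally show ?thesis .
qed

lemma input_size_enc_list_mono:
  assumes "\<And>x. x \<in> set xs \<Longrightarrow> input_size m (f x) \<le> input_size m (g x)"
  shows "input_size m (enc_list (map f xs)) \<le> input_size m (enc_list (map g xs))"
  using assms by (induction xs) (auto intro: add_mono)

lemma input_size_enc_list_rev: "input_size m (enc_list (rev xs)) = input_size m (enc_list xs)"
  unfolding input_size_enc_list by (simp add: rev_map[symmetric])

lemma input_size_enc_matrix_mono:
  assumes "\<And>x y. x \<in> set xs \<Longrightarrow> y \<in> set ys \<Longrightarrow> input_size m (f x y) \<le> input_size m (g x y)"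
  shows "input_size m (enc_matrix f xs ys) \<le> input_size m (enc_matrix g xs ys)"
  unfolding enc_matrix_def by (intro input_size_enc_list_mono) (use assms in auto)

text \<open>The size of a list is a sum over its members and so independent of their order.\<close>

lemma input_size_enc_matrix_rev:
  "input_size m (enc_matrix f (rev xs) (rev ys)) = input_size m (enc_matrix f xs ys)"
proof -
  have "input_size m (enc_matrix f (rev xs) (rev ys)) =
      input_size m (enc_list (map (\<lambda>x. enc_list (rev (map (f x) ys))) xs))"
    unfolding enc_matrix_def by (simp only: rev_map[symmetric] input_size_enc_list_rev)
  also have "\<dots> = input_size m (enc_matrix f xs ys)"
    unfolding enc_matrix_def
    by (intro antisym input_size_enc_list_mono) (simp_all add: input_size_enc_list_rev)
  finally show ?thesis .
qed

text \<open>The nested folds amount to one fold over the concatenated rows.\<close>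

lemma block_max_eq_Max: "block_max b = Max (insert 0 (\<Union>r\<in>set b. set r))"
proof -
  have "fold (fold max) b a = fold max (concat b) a" for a :: real
    by (induction b arbitrary: a) auto
  then have "block_max b = fold max (concat b) 0"
    by (simp add: block_max_def)
  also have "\<dots> = Max (set (0 # concat b))"
    by (simp only: Max.set_eq_fold)
  finally show ?thesis by simp
qed

lemma entry_mem: "entry b i j \<in> insert 0 (set_sexp (enc_block (b i j)))"
proof -
  have "Max (insert 0 (\<Union>r\<in>set (b i j). set r)) \<in> insert 0 (\<Union>r\<in>set (b i j). set r)"
    by (rule Max_in) auto
  then show ?thesis by (auto simp: entry_def block_max_eq_Max set_sexp_enc_block)
qed

text \<open>Every S-expression has size at least 1, the size of 0, and any other entry is an atom of
  its block. Hence replacing blocks by entries does not lengthen the input.\<close>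

lemma input_size_entry: "input_size m (Atom (entry b i j)) \<le> input_size m (enc_block (b i j))"
  using entry_mem[of b i j] num_size_le_input_size[of "entry b i j" "enc_block (b i j)" m]
    input_size_pos[of m "enc_block (b i j)"] by (auto simp: num_size_zero)

section \<open>The instance with worst-case distances\<close>

text \<open>
  Vertices at worst-case distance zero have to share a position, so the points are the least
  members of the classes of vertices at distance zero.
\<close>

lemma pseudometric_nat_realisable:
  fixes D :: "nat \<Rightarrow> nat \<Rightarrow> real"
  assumes nonneg: "\<And>i j. 0 \<le> D i j" and sym: "\<And>i j. D i j = D j i" and refl: "\<And>i. D i i = 0"
    and tri: "\<And>i j k. i \<in> V \<Longrightarrow> j \<in> V \<Longrightarrow> k \<in> V \<Longrightarrow> D i k \<le> D i j + D j k"
  shows "\<exists>M (f :: nat \<Rightarrow> nat). Metric_space M D \<and> (\<forall>i\<in>V. f i \<in> M) \<and>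
    (\<forall>i\<in>V. \<forall>j\<in>V. D (f i) (f j) = D i j)"
proof -
  define f where "f i = (LEAST k. k \<in> V \<and> D i k = 0)" for i
  have f: "f i \<in> V" "D i (f i) = 0" if "i \<in> V" for i
    using LeastI[of "\<lambda>k. k \<in> V \<and> D i k = 0" i] that refl unfolding f_def by auto
  \<comment> \<open>Two triangle inequalities: vertices at distance 0 have the same distance to
    every vertex.\<close>
  have eq: "D i k = D j k" if "i \<in> V" "j \<in> V" "k \<in> V" "D i j = 0" for i j k
    using tri[of i j k] tri[of j i k] that sym[of i j] by auto
  have D: "D (f i) (f j) = D i j" if "i \<in> V" "j \<in> V" for i j
  proof -
    have "D i j = D (f i) j" using eq[of i "f i" j] f that by auto
    also have "\<dots> = D j (f i)" by (rule sym)
    also have "\<dots> = D (f j) (f i)" using eq[of j "f j" "f i"] f that by auto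
    finally show ?thesis by (simp only: sym[of "f j"])
  qed
  have ff: "f i = f j" if "i \<in> V" "j \<in> V" "D i j = 0" for i j
  proof -
    have "(\<lambda>k. k \<in> V \<and> D i k = 0) = (\<lambda>k. k \<in> V \<and> D j k = 0)"
      using eq[OF that(1,2) _ that(3)] by (auto simp: fun_eq_iff)
    then show ?thesis by (simp add: f_def)
  qed
  \<comment> \<open>\<open>Metric_space\<close> demands non-negativity and symmetry for all
    arguments, also outside the carrier, hence the global form of \<open>nonneg\<close> and
    \<open>sym\<close>.\<close>
  have "Metric_space (f ` V) D"
  proof
    fix x y assume "x \<in> f ` V" "y \<in> f ` V"
    then obtain i j where "i \<in> V" "x = f i" "j \<in> V" "y = f j" by blast
    then show "D x y = 0 \<longleftrightarrow> x = y" using D[of i j] ff[of i j] refl[of x] by metis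
  next
    fix x y z assume "x \<in> f ` V" "y \<in> f ` V" "z \<in> f ` V"
    then show "D x z \<le> D x y + D y z" using f(1) by (intro tri) auto
  qed (fact nonneg sym)+
  with D show ?thesis by (intro exI[of _ "f ` V"] exI[of _ f]) simp
qed

section \<open>Worst-case distances of a fixed robust instance\<close>

definition realised :: "'p robust_instance \<Rightarrow> nat \<Rightarrow> nat \<Rightarrow> real set" where
  "realised I i j = {distance I p q | p q. p \<in> uncertainty I i \<and> q \<in> uncertainty I j}"

lemma realised_eq_image:
  "realised I i j = (\<lambda>(p, q). distance I p q) ` (uncertainty I i \<times> uncertainty I j)"
  unfolding realised_def by auto

lemma dist_max_realised: "dist_max I i j = Max (realised I i j)"
  unfolding dist_max_def realised_def ..

context
  fixes P :: problem and \<M> :: "('p set \<times> ('p \<Rightarrow> 'p \<Rightarrow> real)) set" and I :: "'p robust_instance"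
  assumes I: "I \<in> robust_instances P \<M>"
begin

lemma robust_metric: "Metric_space (points I) (distance I)"
  and robust_graph: "is_graph (host I)"
  and robust_feasible: "feasible P I \<noteq> {}"
  using I by (auto simp: robust_instances_def valid_base_def)

lemma robust_uncertainty:
  assumes "i \<in> fst (host I)"
  shows "finite (uncertainty I i)" "uncertainty I i \<noteq> {}" "uncertainty I i \<subseteq> points I"
  using I assms by (auto simp: robust_instances_def)

lemma realised_finite:
  "i \<in> fst (host I) \<Longrightarrow> j \<in> fst (host I) \<Longrightarrow> finite (realised I i j)"
  unfolding realised_eq_image using robust_uncertainty(1) by auto

lemma realised_nonempty:
  "i \<in> fst (host I) \<Longrightarrow> j \<in> fst (host I) \<Longrightarrow> realised I i j \<noteq> {}"
  unfolding realised_eq_image using robust_uncertainty(2) by auto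

lemma distance_le_dist_max:
  assumes "i \<in> fst (host I)" "j \<in> fst (host I)" "p \<in> uncertainty I i" "q \<in> uncertainty I j"
  shows "distance I p q \<le> dist_max I i j"
  unfolding dist_max_realised by (rule Max_ge) (use assms realised_finite in \<open>auto simp: realised_def\<close>)

lemma dist_max_attained:
  assumes "i \<in> fst (host I)" "j \<in> fst (host I)"
  obtains p q where "p \<in> uncertainty I i" "q \<in> uncertainty I j" "dist_max I i j = distance I p q"
proof -
  have "dist_max I i j \<in> realised I i j"
    unfolding dist_max_realised by (rule Max_in[OF realised_finite[OF assms] realised_nonempty[OF assms]])
  then obtain p q where "p \<in> uncertainty I i" "q \<in> uncertainty I j" "dist_max I i j = distance I p q"
    unfolding realised_def by blast
  then show thesis by (rule that)
qed

lemma dist_max_nonneg: "i \<in> fst (host I) \<Longrightarrow> j \<in> fst (host I) \<Longrightarrow> 0 \<le> dist_max I i j"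
  by (rule dist_max_attained[of i j]) (simp_all add: Metric_space.nonneg[OF robust_metric])

lemma dist_max_commute: "dist_max I i j = dist_max I j i"
proof -
  have "realised I i j \<subseteq> realised I j i" for i j
  proof
    fix x assume "x \<in> realised I i j"
    then obtain p q where "p \<in> uncertainty I i" "q \<in> uncertainty I j" "x = distance I p q"
      unfolding realised_def by blast
    moreover have "distance I p q = distance I q p"
      by (rule Metric_space.commute[OF robust_metric])
    ultimately show "x \<in> realised I j i" unfolding realised_def by blast
  qed
  then have "realised I i j = realised I j i" by (intro antisym)
  then show ?thesis by (simp only: dist_max_realised)
qed

text \<open>For a farthest pair of positions p of i and r of k, pass through any position q of j;
  each leg is at most the corresponding worst-case distance.\<close>

lemma dist_max_triangle:
  assumes V: "i \<in> fst (host I)" "j \<in> fst (host I)" "k \<in> fst (host I)"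
  shows "dist_max I i k \<le> dist_max I i j + dist_max I j k"
proof -
  obtain p r where pr: "p \<in> uncertainty I i" "r \<in> uncertainty I k" "dist_max I i k = distance I p r"
    using dist_max_attained[OF V(1,3)] .
  obtain q where q: "q \<in> uncertainty I j" using robust_uncertainty(2) V by blast
  have "distance I p r \<le> distance I p q + distance I q r"
    by (rule Metric_space.triangle[OF robust_metric]) (use pr q V robust_uncertainty(3) in blast)+
  also have "\<dots> \<le> dist_max I i j + dist_max I j k"
    by (intro add_mono distance_le_dist_max) (use V pr q in auto)
  finally show ?thesis using pr by simp
qed

text \<open>The value 0 off the vertex set gives non-negativity and symmetry for all natural
  numbers; on the diagonal it replaces the diameter.\<close>

definition vertex_distance :: "nat \<Rightarrow> nat \<Rightarrow> real" where
  "vertex_distance i j =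
     (if i = j \<or> i \<notin> fst (host I) \<or> j \<notin> fst (host I) then 0 else dist_max I i j)"

text \<open>The last property also fixes the diagonal, which \<open>worst_case_instance\<close>
  leaves open but the encoded matrix contains.\<close>

lemma worst_case_instance_exists:
  obtains J :: "nat nominal_instance" where "J \<in> nominal_instances P" "worst_case_instance I J"
    "\<And>i j. i \<in> fst (host I) \<Longrightarrow> j \<in> fst (host I) \<Longrightarrow>
       distance J (position J i) (position J j) = vertex_distance i j"
proof -
  have "0 \<le> vertex_distance i j" for i j
    by (simp add: vertex_distance_def dist_max_nonneg)
  moreover have "vertex_distance i j = vertex_distance j i" for i j
    using dist_max_commute[of i j] by (simp add: vertex_distance_def)
  moreover have "vertex_distance i i = 0" for i
    by (simp add: vertex_distance_def)
  \<comment> \<open>For i = k the left side is 0. Otherwise, if j is i or k, one summand on the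
    right vanishes and the other equals the left side.\<close>
  moreover have "vertex_distance i k \<le> vertex_distance i j + vertex_distance j k"
    if "i \<in> fst (host I)" "j \<in> fst (host I)" "k \<in> fst (host I)" for i j k
    using that dist_max_triangle[of i j k] dist_max_nonneg[of i j] dist_max_nonneg[of j k]
    by (cases "i = k") (simp_all add: vertex_distance_def)
  ultimately have "\<exists>M (f :: nat \<Rightarrow> nat). Metric_space M vertex_distance \<and> (\<forall>i\<in>fst (host I). f i \<in> M) \<and>
    (\<forall>i\<in>fst (host I). \<forall>j\<in>fst (host I). vertex_distance (f i) (f j) = vertex_distance i j)"
    by (rule pseudometric_nat_realisable)
  then obtain M and f :: "nat \<Rightarrow> nat" where f: "Metric_space M vertex_distance"
      "\<And>i. i \<in> fst (host I) \<Longrightarrow> f i \<in> M"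
      "\<And>i j. i \<in> fst (host I) \<Longrightarrow> j \<in> fst (host I) \<Longrightarrow> vertex_distance (f i) (f j) = vertex_distance i j"
    by blast
  define J where "J = \<lparr>host = host I, param = param I, points = M, distance = vertex_distance, position = f\<rparr>"
  show thesis
  proof (rule that[of J])
    show "J \<in> nominal_instances P"
      using f robust_graph robust_feasible
      by (auto simp: J_def nominal_instances_def valid_base_def feasible_def)
    show "worst_case_instance I J"
      using f by (simp add: J_def worst_case_instance_def vertex_distance_def)
  qed (simp add: J_def f)
qed

text \<open>A block is non-empty and contains no negative number, so starting its maximum at 0 does
  no harm.\<close>

lemma entry_eq_vertex_distance:
  assumes "i \<in> fst (host I)" "j \<in> fst (host I)"
    and "set (L i) = uncertainty I i" "set (L j) = uncertainty I j"
  shows "entry (\<lambda>i j. map (\<lambda>p. map (distance I p) (L j)) (L i)) i j = vertex_distance i j"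
proof -
  have "(\<Union>r\<in>set (map (\<lambda>p. map (distance I p) (L j)) (L i)). set r) = realised I i j"
    using assms by (auto simp: realised_def)
  moreover have "Max (insert 0 (realised I i j)) = dist_max I i j"
    using realised_finite[OF assms(1,2)] realised_nonempty[OF assms(1,2)] dist_max_nonneg[OF assms(1,2)]
    by (simp add: dist_max_realised)
  ultimately show ?thesis
    using assms by (simp add: entry_def block_max_eq_Max vertex_distance_def)
qed

end

section \<open>Approximation guarantee\<close>

text \<open>\<open>edge_sum\<close> evaluates an edge at its least and greatest member; as these
  differ, diagonal values never enter a cost.\<close>

lemma edge_endpoints:
  assumes "subgraph_of G H" "e \<in> snd G"
  shows "Min e \<in> fst H" "Max e \<in> fst H" "Min e \<noteq> Max e"
proof -
  have e: "card e = 2" "e \<subseteq> fst H"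
    using assms by (auto simp: subgraph_of_def is_graph_def)
  then have "finite e" "e \<noteq> {}" by (auto intro: card_ge_0_finite)
  then show "Min e \<in> fst H" "Max e \<in> fst H"
    using e(2) Min_in Max_in by blast+
  show "Min e \<noteq> Max e"
  proof
    assume "Min e = Max e"
    then have "x = Min e" if "x \<in> e" for x
      using Min_le[OF \<open>finite e\<close> that] Max_ge[OF \<open>finite e\<close> that] by simp
    then have "e \<subseteq> {Min e}" by blast
    then show False using e(1) card_mono[of "{Min e}" e] by simp
  qed
qed

lemma edge_sum_mono:
  assumes "subgraph_of G H"
    and "\<And>i j. i \<in> fst H \<Longrightarrow> j \<in> fst H \<Longrightarrow> i \<noteq> j \<Longrightarrow> w i j \<le> w' i j"
  shows "edge_sum w G \<le> edge_sum w' G"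
  unfolding edge_sum_def by (intro sum_mono assms(2) edge_endpoints[OF assms(1)])

lemma edge_sum_cong:
  assumes "subgraph_of G H"
    and "\<And>i j. i \<in> fst H \<Longrightarrow> j \<in> fst H \<Longrightarrow> i \<noteq> j \<Longrightarrow> w i j = w' i j"
  shows "edge_sum w G = edge_sum w' G"
  by (intro antisym edge_sum_mono[OF assms(1)]) (simp_all add: assms(2))

text \<open>Makes feasible families finite, so that \<open>Min\<close> over their costs is an
  attained minimum.\<close>

lemma finite_subgraphs: "is_graph H \<Longrightarrow> finite {G. subgraph_of G H}"
proof -
  assume H: "is_graph H"
  then have "{G. subgraph_of G H} \<subseteq> Pow (fst H) \<times> Pow (Pow (fst H))"
    by (fastforce simp: subgraph_of_def is_graph_def)
  then show ?thesis by (rule finite_subset) (use H in \<open>simp add: is_graph_def\<close>)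
qed

lemma nominal_cost_worst_case_instance:
  assumes "worst_case_instance I J" "subgraph_of G (host I)"
  shows "nominal_cost J G = cost_max I G"
  unfolding nominal_cost_def cost_max_def
  by (rule edge_sum_cong[OF assms(2)]) (use assms(1) in \<open>simp add: worst_case_instance_def\<close>)

text \<open>The maximum is attained by some choice u of positions, and at u each edge is at most as
  long as its worst-case distance.\<close>

lemma robust_cost_bounds:
  assumes I: "I \<in> robust_instances P \<M>" and G: "subgraph_of G (host I)"
  shows "0 \<le> robust_cost I G" "robust_cost I G \<le> cost_max I G"
proof -
  let ?U = "Pi\<^sub>E (fst (host I)) (uncertainty I)"
  let ?f = "\<lambda>u. edge_sum (\<lambda>i j. distance I (u i) (u j)) G"
  have "finite ?U"
    using robust_graph[OF I] robust_uncertainty(1)[OF I] by (intro finite_PiE) (auto simp: is_graph_def)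
  moreover have "?U \<noteq> {}"
    using robust_uncertainty(2)[OF I] by (simp add: PiE_eq_empty_iff)
  ultimately have "Max (?f ` ?U) \<in> ?f ` ?U" by (intro Max_in) auto
  then obtain u where u: "u \<in> ?U" "robust_cost I G = ?f u"
    unfolding robust_cost_def by blast
  show "0 \<le> robust_cost I G"
    unfolding u(2) edge_sum_def by (intro sum_nonneg Metric_space.nonneg[OF robust_metric[OF I]])
  show "robust_cost I G \<le> cost_max I G"
    unfolding u(2) cost_max_def
    by (rule edge_sum_mono[OF G], rule distance_le_dist_max[OF I]) (use u(1) in auto)
qed

text \<open>Let H minimise the robust cost. For \<open>\<rho>\<^sub>1 \<ge> 0\<close> the chain is
  \<open>robust_cost I G\<close> \<le> \<open>cost_max I G\<close> \<le>
  \<open>\<rho>\<^sub>1 * cost_max I H\<close> \<le>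
  \<open>\<rho>\<^sub>1 * \<rho>\<^sub>2 * robust_cost I H\<close>.\<close>

lemma robust_approximation:
  assumes P: "P \<in> problem_class" and I: "I \<in> robust_instances P \<M>"
    and \<rho>2: "\<forall>G\<in>feasible P I. cost_max I G \<le> \<rho>\<^sub>2 * robust_cost I G"
    and J: "worst_case_instance I J" and G: "G \<in> feasible P I"
    and \<rho>1: "nominal_cost J G \<le> \<rho>\<^sub>1 * Min (nominal_cost J ` feasible P J)"
  shows "robust_cost I G \<le> \<rho>\<^sub>1 * \<rho>\<^sub>2 * Min (robust_cost I ` feasible P I)"
proof -
  let ?F = "feasible P I"
  have sub: "subgraph_of H (host I)" if "H \<in> ?F" for H
    using P that robust_graph[OF I] unfolding problem_class_def feasible_def by blast
  have fin: "finite ?F"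
    by (rule finite_subset[OF _ finite_subgraphs[OF robust_graph[OF I]]]) (use sub in auto)
  have "feasible P J = ?F"
    using J by (simp add: feasible_def worst_case_instance_def)
  then have min_eq: "Min (nominal_cost J ` feasible P J) = Min (cost_max I ` ?F)"
    using nominal_cost_worst_case_instance[OF J sub] by (simp cong: image_cong)
  have le: "cost_max I G \<le> \<rho>\<^sub>1 * Min (cost_max I ` ?F)"
    using \<rho>1 nominal_cost_worst_case_instance[OF J sub[OF G]] unfolding min_eq by simp
  note bounds = robust_cost_bounds[OF I sub]
  have nonneg: "0 \<le> cost_max I H" if "H \<in> ?F" for H
    using bounds[OF that] by linarith
  have "Min (robust_cost I ` ?F) \<in> robust_cost I ` ?F"
    using fin G by (intro Min_in) auto
  then obtain H where H: "H \<in> ?F" "Min (robust_cost I ` ?F) = robust_cost I H" by blast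
  have minH: "robust_cost I H \<le> robust_cost I G"
    unfolding H(2)[symmetric] using fin G by (intro Min_le) auto
  show ?thesis
  proof (cases "\<rho>\<^sub>1 \<ge> 0")
    case True
    have "Min (cost_max I ` ?F) \<le> cost_max I H" using fin H by (intro Min_le) auto
    also have "\<dots> \<le> \<rho>\<^sub>2 * robust_cost I H" using \<rho>2 H by blast
    finally have "\<rho>\<^sub>1 * Min (cost_max I ` ?F) \<le> \<rho>\<^sub>1 * (\<rho>\<^sub>2 * robust_cost I H)"
      using True by (rule mult_left_mono)
    then show ?thesis using le bounds(2)[OF G] by (simp add: H mult.assoc)
  next
    \<comment> \<open>A negative ratio forces all the costs involved to vanish.\<close>
    case False
    have "0 \<le> Min (cost_max I ` ?F)"
      using fin G nonneg by (subst Min_ge_iff) auto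
    then have "\<rho>\<^sub>1 * Min (cost_max I ` ?F) \<le> 0"
      using False by (simp add: mult_nonpos_nonneg)
    then have "robust_cost I G = 0" using le bounds[OF G] by linarith
    then show ?thesis using minH bounds(1)[OF H(1)] by (simp add: H)
  qed
qed

section \<open>The algorithm\<close>

text \<open>The given algorithm runs on an input that may be shorter than the original one; this
  carries its time bound over.\<close>

lemma poly_nat_mono: "x \<le> y \<Longrightarrow> poly (q :: nat poly) x \<le> poly q y"
  by (induction q) (auto intro: mult_le_mono)

text \<open>Degree five: four nested loops of at most N rounds each, over rows of blocks, blocks,
  rows within a block and numbers, with comparisons of cost linear in N.\<close>

definition time_poly :: "nat poly" where
  "time_poly = (let X = [:0, 1:] in
     X * (X * (X * (X * (2 * X + 10 + 2) + 8 + 2) + 4 * X + 40 + 2) + 40 + 2) + 40)"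

lemma poly_time_poly: "poly time_poly N = N * (N * (entry_time N + 2) + 40 + 2) + 40"
  by (simp add: time_poly_def entry_time_def Let_def algebra_simps)

text \<open>The input size serves as the single bound N for the number of vertices, the block
  dimensions and the sizes of all numbers.\<close>

lemma worst_case_prog_correct:
  assumes I: "I \<in> robust_instances P \<M>" and t: "encodes_robust I t" "set_sexp t \<subseteq> numbers m"
  obtains J :: "nat nominal_instance" and t' where
    "J \<in> nominal_instances P" "worst_case_instance I J" "encodes_nominal J t'"
    "set_sexp t' \<subseteq> numbers m" "input_size m t' \<le> input_size m t"
    "runs m worst_case_prog ((\<lambda>_. Emp)(0 := t)) (poly time_poly (input_size m t)) ((\<lambda>_. Emp)(0 := t'))"
proof -
  obtain vs es L where vs: "lists_graph vs es (host I)"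
    and L: "\<forall>i\<in>set vs. distinct (L i) \<and> set (L i) = uncertainty I i"
    and t_eq: "t = Pair (enc_graph vs es) (Pair (param I)
       (enc_matrix (\<lambda>i j. enc_matrix (\<lambda>p q. Atom (distance I p q)) (L i) (L j)) vs vs))"
    using t(1) unfolding encodes_robust_def by blast
  define b where "b i j = map (\<lambda>p. map (distance I p) (L j)) (L i)" for i j
  define N where "N = input_size m t"
  define es' where "es' = enc_list (map (\<lambda>(i, j). Pair (enc_nat i) (enc_nat j)) es)"
  have V: "set vs = fst (host I)" using vs by (simp add: lists_graph_def)
  let ?M = "enc_matrix (\<lambda>i j. enc_block (b i j)) vs vs"
  have "enc_matrix (\<lambda>p q. Atom (distance I p q)) (L i) (L j) = enc_block (b i j)" for i j
    by (simp add: enc_matrix_def enc_block_def b_def o_def)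
  then have t_eq': "t = Pair (Pair (enc_list (map enc_nat vs)) es') (Pair (param I) ?M)"
    unfolding t_eq enc_graph_def es'_def by simp
  have sizes: "input_size m (enc_list (map enc_nat vs)) \<le> N" "input_size m ?M \<le> N"
    by (simp_all add: N_def t_eq')
  define t' where "t' = Pair (Pair (enc_list (map enc_nat (rev vs))) es')
       (Pair (param I) (enc_matrix (\<lambda>i j. Atom (entry b i j)) (rev vs) (rev vs)))"
  obtain J :: "nat nominal_instance" where J: "J \<in> nominal_instances P" "worst_case_instance I J"
    "\<And>i j. i \<in> fst (host I) \<Longrightarrow> j \<in> fst (host I) \<Longrightarrow>
       distance J (position J i) (position J j) = vertex_distance I i j"
    using worst_case_instance_exists[OF I] by blast
  have "entry b i j = distance J (position J i) (position J j)" if "i \<in> set vs" "j \<in> set vs" for i j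
    using entry_eq_vertex_distance[OF I, of i j L] J(3)[of i j] L that V by (simp add: b_def[abs_def])
  then have "enc_matrix (\<lambda>i j. Atom (entry b i j)) (rev vs) (rev vs) =
      enc_matrix (\<lambda>i j. Atom (distance J (position J i) (position J j))) (rev vs) (rev vs)"
    unfolding enc_matrix_def by (intro arg_cong[where f = enc_list] map_cong) auto
  then have "t' = Pair (enc_graph (rev vs) es) (Pair (param J)
      (enc_matrix (\<lambda>i j. Atom (distance J (position J i) (position J j))) (rev vs) (rev vs)))"
    using J(2) by (simp add: t'_def enc_graph_def es'_def worst_case_instance_def)
  \<comment> \<open>An encoding may list the vertices in any order, so the reversal is
    harmless.\<close>
  moreover have "lists_graph (rev vs) es (host J)"
    using vs J(2) by (simp add: lists_graph_def worst_case_instance_def)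
  ultimately have "encodes_nominal J t'"
    unfolding encodes_nominal_def by blast
  moreover have "set_sexp t' \<subseteq> numbers m"
  proof -
    have "set_sexp t' \<subseteq> insert 0 (set_sexp t)"
      using entry_mem[of b] unfolding t'_def t_eq'
      by (auto simp: set_sexp_enc_list set_sexp_enc_matrix) blast
    moreover have "0 \<in> numbers m" by (cases m) auto
    ultimately show ?thesis using t(2) by blast
  qed
  moreover have "input_size m t' \<le> input_size m t"
    using input_size_enc_matrix_mono[of vs vs m "\<lambda>i j. Atom (entry b i j)" "\<lambda>i j. enc_block (b i j)",
        OF input_size_entry]
    unfolding t'_def t_eq'
    by (simp add: input_size_enc_matrix_rev rev_map[symmetric] input_size_enc_list_rev)
  moreover have "runs m worst_case_prog ((\<lambda>_. Emp)(0 := t)) (poly time_poly (input_size m t))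
      ((\<lambda>_. Emp)(0 := t'))"
    unfolding poly_time_poly t'_def N_def[symmetric] unfolding t_eq'
  proof (rule runs_worst_case_prog)
    show "\<forall>j\<in>set vs. num_size m (real j) \<le> N"
      unfolding N_def by (intro ballI num_size_le_input_size) (auto simp: t_eq' set_sexp_enc_list enc_nat_def)
    show "\<forall>i\<in>set vs. \<forall>j\<in>set vs. bounded_block m N (b i j)"
    proof (intro ballI)
      fix i j assume "i \<in> set vs" "j \<in> set vs"
      then have "input_size m (enc_block (b i j)) \<le> N"
        using input_size_enc_matrix_mem[of i vs j vs m "\<lambda>i j. enc_block (b i j)"] sizes(2) by simp
      then show "bounded_block m N (b i j)"
        by (rule bounded_block_mono[OF bounded_block_input_size])
    qed
    show "length vs \<le> N"
      using length_le_input_size[of "map enc_nat vs" m] sizes(1) by simp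
    show "num_size m 0 \<le> N"
      unfolding num_size_zero N_def by (rule input_size_pos)
  qed
  ultimately show thesis by (rule that[OF J(1,2)])
qed

text \<open>\<open>c\<close> stops in exactly the store in which a program with input t' starts,
  which is why the auxiliary variables have to be emptied. Determinism excludes any other
  continuation.\<close>

lemma outputs_Seq_runs:
  assumes "runs m c ((\<lambda>_. Emp)(0 := t)) n ((\<lambda>_. Emp)(0 := t'))"
  shows "(\<exists>k. outputs m (Seq c A) t k out) \<longleftrightarrow> (\<exists>k. outputs m A t' k out)"
    and "outputs m A t' k out \<Longrightarrow> \<exists>l\<le>n + k. outputs m (Seq c A) t l out"
proof -
  obtain l where l: "l \<le> n" "exec m c ((\<lambda>_. Emp)(0 := t)) l ((\<lambda>_. Emp)(0 := t'))"
    using assms unfolding runs_def by blast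
  have fwd: "outputs m (Seq c A) t (l + k) out" if "outputs m A t' k out" for k
    using that l(2) unfolding outputs_def by (blast intro: exec_Seq)
  have "\<exists>k. outputs m A t' k out" if "outputs m (Seq c A) t k out" for k
  proof -
    from that obtain s where s: "exec m (Seq c A) ((\<lambda>_. Emp)(0 := t)) k s" "s 0 = out"
      unfolding outputs_def by blast
    from s(1) obtain s' k1 k2 where "exec m c ((\<lambda>_. Emp)(0 := t)) k1 s'" "exec m A s' k2 s"
      by (cases rule: exec.cases) auto
    then show ?thesis using exec_deterministic[OF l(2)] s(2) unfolding outputs_def by blast
  qed
  with fwd show "(\<exists>k. outputs m (Seq c A) t k out) \<longleftrightarrow> (\<exists>k. outputs m A t' k out)" by blast
  show "\<exists>l\<le>n + k. outputs m (Seq c A) t l out" if "outputs m A t' k out"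
    using fwd[OF that] l(1) by (intro exI[of _ "l + k"]) simp
qed

theorem theorem1:
  fixes m :: cost_model and P :: problem and A :: com and \<rho>\<^sub>1 \<rho>\<^sub>2 :: real
    and \<M> :: "('p set \<times> ('p \<Rightarrow> 'p \<Rightarrow> real)) set"
  assumes "P \<in> problem_class"
    and "approximates_problem m P \<rho>\<^sub>1 A"
    and "\<forall>I\<in>robust_instances P \<M>. \<forall>G\<in>feasible P I. cost_max I G \<le> \<rho>\<^sub>2 * robust_cost I G"
  shows "\<exists>B. applies_to_worst_case m P \<M> A B \<and> approximates_robust m P \<M> (\<rho>\<^sub>1 * \<rho>\<^sub>2) B"
proof (intro exI conjI)
  let ?B = "Seq worst_case_prog A"
  show "applies_to_worst_case m P \<M> A ?B"
    unfolding applies_to_worst_case_def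
  proof (intro ballI allI impI, elim conjE)
    fix I :: "'p robust_instance" and t
    assume "I \<in> robust_instances P \<M>" "encodes_robust I t" "set_sexp t \<subseteq> numbers m"
    then obtain J :: "nat nominal_instance" and t' where
      "J \<in> nominal_instances P" "worst_case_instance I J" "encodes_nominal J t'" "set_sexp t' \<subseteq> numbers m"
      and r: "runs m worst_case_prog ((\<lambda>_. Emp)(0 := t)) (poly time_poly (input_size m t)) ((\<lambda>_. Emp)(0 := t'))"
      by (rule worst_case_prog_correct)
    then show "\<exists>J\<in>nominal_instances P :: nat nominal_instance set. \<exists>t'. worst_case_instance I J \<and>
        encodes_nominal J t' \<and> set_sexp t' \<subseteq> numbers m \<and>
        (\<forall>out. (\<exists>k. outputs m ?B t k out) \<longleftrightarrow> (\<exists>k. outputs m A t' k out))"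
      using outputs_Seq_runs(1)[OF r] by blast
  qed
  obtain q :: "nat poly" where q: "\<And>J t. J \<in> (nominal_instances P :: nat nominal_instance set) \<Longrightarrow>
      encodes_nominal J t \<Longrightarrow> set_sexp t \<subseteq> numbers m \<Longrightarrow>
      \<exists>k out G. outputs m A t k out \<and> k \<le> poly q (input_size m t) \<and> encodes_graph G out \<and>
        G \<in> feasible P J \<and> nominal_cost J G \<le> \<rho>\<^sub>1 * Min (nominal_cost J ` feasible P J)"
    using assms(2) unfolding approximates_problem_def polynomial_approximation_def by blast
  show "approximates_robust m P \<M> (\<rho>\<^sub>1 * \<rho>\<^sub>2) ?B"
    unfolding approximates_robust_def polynomial_approximation_def
  \<comment> \<open>\<open>time_poly\<close> pays for building the matrix and \<open>q\<close> for
    running \<open>A\<close> on it.\<close>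
  proof (intro exI[of _ "time_poly + q"] ballI allI impI, elim conjE)
    fix I :: "'p robust_instance" and t
    assume I: "I \<in> robust_instances P \<M>" and "encodes_robust I t" "set_sexp t \<subseteq> numbers m"
    then obtain J :: "nat nominal_instance" and t' where J: "J \<in> nominal_instances P"
      "worst_case_instance I J" "encodes_nominal J t'" "set_sexp t' \<subseteq> numbers m"
      and size: "input_size m t' \<le> input_size m t"
      and r: "runs m worst_case_prog ((\<lambda>_. Emp)(0 := t)) (poly time_poly (input_size m t)) ((\<lambda>_. Emp)(0 := t'))"
      by (rule worst_case_prog_correct)
    from q[OF J(1,3,4)] obtain k out G where A: "outputs m A t' k out" "k \<le> poly q (input_size m t')"
      and G: "encodes_graph G out" "G \<in> feasible P J"
        "nominal_cost J G \<le> \<rho>\<^sub>1 * Min (nominal_cost J ` feasible P J)" by blast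
    have GI: "G \<in> feasible P I"
      using G(2) J(2) by (simp add: feasible_def worst_case_instance_def)
    obtain l where l: "l \<le> poly time_poly (input_size m t) + k" "outputs m ?B t l out"
      using outputs_Seq_runs(2)[OF r A(1)] by blast
    have "l \<le> poly (time_poly + q) (input_size m t)"
      using l(1) A(2) poly_nat_mono[OF size, of q] by simp
    moreover have "robust_cost I G \<le> \<rho>\<^sub>1 * \<rho>\<^sub>2 * Min (robust_cost I ` feasible P I)"
      using robust_approximation[OF assms(1) I _ J(2) GI G(3)] assms(3) I by blast
    ultimately show "\<exists>k out G. outputs m ?B t k out \<and> k \<le> poly (time_poly + q) (input_size m t) \<and>
        encodes_graph G out \<and> G \<in> feasible P I \<and>
        robust_cost I G \<le> \<rho>\<^sub>1 * \<rho>\<^sub>2 * Min (robust_cost I ` feasible P I)"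
      using l(2) G(1) GI by blast
  qed
qed

end
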